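(* Let $\widetilde F:\mathbb R^m\to\mathbb R$ be continuously differentiable with $L$-Lipschitz gradient, $L>0$: $\|\nabla\widetilde F(x)-\nabla\widetilde F(y)\|_2\le L\|x-y\|_2$ for all $x,y\in\mathbb R^m$. Let $(z_k)_{k\in\mathbb N_0}$ be defined by $z_{k+1}=z_k+t_ks_k$, with $z_0\in\mathbb R^m$ and $t_k>0$, and for each $k$ let $g_k=\overline\nabla\widetilde F(z_k)\in\mathbb R^m$ be the inexact gradient at $z_k$. Suppose that: (i) there is $\widetilde F_{\inf}\in\mathbb R$ with $\widetilde F(z_k)\ge\widetilde F_{\inf}$ for all $k\in\mathbb N_0$; (ii) there are $c_1',c_2'>0$ with $c_1'/c_2'\le1$ such that $c_1'\|g_k\|_2^2\le-g_k^{\mathsf T}s_k$ and $\|s_k\|_2\le c_2'\|g_k\|_2$ for all $k\in\mathbb N_0$; (iii) for some $\zeta\in[0,c_1'/c_2')$, $\|g_k-\nabla\widetilde F(z_k)\|_2\le\zeta\|g_k\|_2$ for all $k\in\mathbb N_0$; (iv) there exist constants $\overline t>0$ and $\gamma>0$ such that $\overline t\le\frac{2c_1-\gamma}{c_2^2L}$ and $t_k\in\left[\overline t,\frac{2c_1-\gamma}{c_2^2L}\right]$ for all $k\in\mathbb N_0$, where $c_1=\frac{c_1'-\zeta c_2'}{(1+\zeta)^2}$ and $c_2=\frac{c_2'}{1-\zeta}$. Then $$\lim_{k\to\infty}\nabla\widetilde F(z_k)=0,\qquad\lim_{k\to\infty}\overline\nabla\widetilde F(z_k)=0.$$ Moreover,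 every limit point of $(z_k)_{k\in\mathbb N_0}$ is a stationary point of $\widetilde F$.
   Context: $\|\cdot\|_2$ is the Euclidean norm and $\mathbb N_0=\{0,1,2,\dots\}$. The inexact gradient $\overline\nabla\widetilde F(z_k)$ is an arbitrary vector in $\mathbb R^m$ approximating $\nabla\widetilde F(z_k)$, subject only to the stated hypotheses. A limit point of a sequence is the limit of some subsequence; a stationary point is a point where $\nabla\widetilde F$ vanishes. *)

theory Defs
  imports "HOL-Analysis.Analysis"
begin

end

theory Submission
  imports Defs
begin

text \<open>
  The angle and length conditions on the steps survive the passage from inexact to exact gradients:
  \<open>\<nabla>F(z\<^sub>k) \<bullet> s\<^sub>k \<le> - c\<^sub>1 \<parallel>\<nabla>F(z\<^sub>k)\<parallel>\<^sup>2\<close> and \<open>\<parallel>s\<^sub>k\<parallel> \<le> c\<^sub>2 \<parallel>\<nabla>F(z\<^sub>k)\<parallel>\<close>. The quadratic upper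
  bound for functions with Lipschitz gradient then gives a decrease
  \<open>F(z\<^bsub>k+1\<^esub>) \<le> F(z\<^sub>k) - t\<^sub>k \<gamma>/2 \<parallel>\<nabla>F(z\<^sub>k)\<parallel>\<^sup>2\<close>. Since the step sizes are bounded away from zero
  and the values of \<open>F\<close> are bounded below, the exact gradients tend to zero, and the inexact ones
  are dominated by them.
\<close>

text \<open>Along the segment from \<open>x\<close> to \<open>x + h\<close>, subtract the claimed
  bound from \<open>F\<close>, up to the constant \<open>F x\<close>. By Cauchy-Schwarz and the
  Lipschitz condition, the derivative of this difference \<open>\<phi>\<close> is nonpositive for
  \<open>u \<ge> 0\<close>, so comparing \<open>\<phi> 1\<close> with \<open>\<phi> 0\<close> gives
  the bound without integration.\<close>

lemma lipschitz_gradient_upper_bound: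
  fixes F :: "'a::real_inner \<Rightarrow> real"
  assumes grad: "\<And>x. GDERIV F x :> G x"
    and lip: "\<And>x y. norm (G x - G y) \<le> L * norm (x - y)"
  shows "F (x + h) \<le> F x + G x \<bullet> h + L / 2 * (norm h)\<^sup>2"
proof -
  define \<phi> where "\<phi> u = F (x + u *\<^sub>R h) - u * (G x \<bullet> h) - L / 2 * u\<^sup>2 * (norm h)\<^sup>2" for u :: real
  have der: "(\<phi> has_real_derivative (G (x + u *\<^sub>R h) - G x) \<bullet> h - L * u * (norm h)\<^sup>2) (at u)" for u
  proof -
    have "(F has_derivative (\<lambda>d. d \<bullet> G (x + u *\<^sub>R h))) (at (x + u *\<^sub>R h))"
      using grad by (simp add: gderiv_def)
    moreover have "((\<lambda>u. x + u *\<^sub>R h) has_derivative (\<lambda>d. d *\<^sub>R h)) (at u)"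
      by (auto intro!: derivative_eq_intros)
    ultimately have "((\<lambda>u. F (x + u *\<^sub>R h)) has_derivative (\<lambda>d. (d *\<^sub>R h) \<bullet> G (x + u *\<^sub>R h))) (at u)"
      by (rule has_derivative_compose[rotated])
    then have "((\<lambda>u. F (x + u *\<^sub>R h)) has_real_derivative G (x + u *\<^sub>R h) \<bullet> h) (at u)"
      by (simp add: has_field_derivative_def inner_commute mult.commute[of _ "h \<bullet> _"])
    then show ?thesis
      unfolding \<phi>_def by (auto intro!: derivative_eq_intros simp: inner_diff_left)
  qed
  have "(G (x + u *\<^sub>R h) - G x) \<bullet> h - L * u * (norm h)\<^sup>2 \<le> 0" if "0 \<le> u" for u
  proof -
    have "(G (x + u *\<^sub>R h) - G x) \<bullet> h \<le> norm (G (x + u *\<^sub>R h) - G x) * norm h"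
      by (rule norm_cauchy_schwarz)
    also have "\<dots> \<le> (L * norm (u *\<^sub>R h)) * norm h"
      using lip[of "x + u *\<^sub>R h" x] by (intro mult_right_mono) auto
    finally show ?thesis
      using that by (simp add: power2_eq_square mult.assoc)
  qed
  with der have "\<phi> 1 \<le> \<phi> 0"
    by (intro DERIV_nonpos_imp_nonincreasing[of 0 1]) (simp, blast)
  then show ?thesis
    by (simp add: \<phi>_def)
qed

text \<open>The sequence \<open>f\<close> decreases and is bounded below, hence converges; its
  decrements therefore vanish and squeeze \<open>a\<close> to zero.\<close>

lemma tendsto_zero_if_le_decrement:
  fixes a f :: "nat \<Rightarrow> real"
  assumes nonneg: "\<And>k. 0 \<le> a k"
    and decr: "\<And>k. a k \<le> f k - f (Suc k)"
    and bound: "\<And>k. m \<le> f k"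
  shows "a \<longlonglongrightarrow> 0"
proof -
  have "decseq f"
    using nonneg decr by (intro decseq_SucI) (meson diff_ge_0_iff_ge order_trans)
  then obtain l where l: "f \<longlonglongrightarrow> l"
    using decseq_convergent bound by metis
  then have "(\<lambda>k. f k - f (Suc k)) \<longlonglongrightarrow> 0"
    using tendsto_diff[OF l LIMSEQ_Suc[OF l]] by simp
  then show ?thesis
    by (rule tendsto_sandwich[OF always_eventually always_eventually tendsto_const, rotated 2])
      (use nonneg decr in blast)+
qed

theorem theorem5p5:
  fixes F :: "real ^ 'm \<Rightarrow> real"
    and gradF :: "real ^ 'm \<Rightarrow> real ^ 'm"
    and z s g :: "nat \<Rightarrow> real ^ 'm"
    and t :: "nat \<Rightarrow> real"
    and L F_inf c1' c2' c1 c2 \<zeta> \<gamma> t_bar :: real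
  assumes grad: "\<And>x. GDERIV F x :> gradF x"
    and cont_grad: "continuous_on UNIV gradF"
    and L_pos: "L > 0"
    and lipschitz_grad: "\<And>x y. norm (gradF x - gradF y) \<le> L * norm (x - y)"
    and t_pos: "\<And>k. t k > 0"
    and step: "\<And>k. z (Suc k) = z k + t k *\<^sub>R s k"
    and bounded_below: "\<And>k. F (z k) \<ge> F_inf"
    and c1'_pos: "c1' > 0"
    and c2'_pos: "c2' > 0"
    and c1'_c2': "c1' / c2' \<le> 1"
    and descent: "\<And>k. c1' * (norm (g k))\<^sup>2 \<le> - (g k \<bullet> s k)"
    and direction_bound: "\<And>k. norm (s k) \<le> c2' * norm (g k)"
    and zeta: "\<zeta> \<in> {0..<c1' / c2'}"
    and inexact: "\<And>k. norm (g k - gradF (z k)) \<le> \<zeta> * norm (g k)"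
    and c1: "c1 = (c1' - \<zeta> * c2') / (1 + \<zeta>)\<^sup>2"
    and c2: "c2 = c2' / (1 - \<zeta>)"
    and t_bar_pos: "t_bar > 0"
    and gamma_pos: "\<gamma> > 0"
    and t_bar_le: "t_bar \<le> (2 * c1 - \<gamma>) / (c2\<^sup>2 * L)"
    and step_size: "\<And>k. t k \<in> {t_bar..(2 * c1 - \<gamma>) / (c2\<^sup>2 * L)}"
  shows "(\<lambda>k. gradF (z k)) \<longlonglongrightarrow> 0 \<and> g \<longlonglongrightarrow> 0 \<and>
    (\<forall>x. (\<exists>r :: nat \<Rightarrow> nat. strict_mono r \<and> (z \<circ> r) \<longlonglongrightarrow> x) \<longrightarrow> gradF x = 0)"
proof -
  have \<zeta>0: "0 \<le> \<zeta>" and \<zeta>1: "\<zeta> < 1"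
    using zeta c1'_c2' unfolding atLeastLessThan_iff by linarith+
  have \<zeta>c: "\<zeta> * c2' < c1'"
    using zeta c2'_pos by (simp add: pos_less_divide_eq)
  have c2_pos: "c2 > 0"
    using c2 c2'_pos \<zeta>1 by simp
  \<comment> \<open>The relative error makes the two gradient norms comparable; these factors are
    the origin of the denominators of \<open>c1\<close> and \<open>c2\<close>.\<close>
  have upper: "norm (gradF (z k)) \<le> (1 + \<zeta>) * norm (g k)" for k
    using inexact[of k] norm_triangle_ineq2[of "gradF (z k)" "g k"]
    by (simp add: norm_minus_commute algebra_simps)
  have lower: "norm (g k) \<le> norm (gradF (z k)) / (1 - \<zeta>)" for k
    using inexact[of k] norm_triangle_ineq2[of "g k" "gradF (z k)"] \<zeta>1
    by (simp add: pos_le_divide_eq algebra_simps)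
  have slope: "gradF (z k) \<bullet> s k \<le> - c1 * (norm (gradF (z k)))\<^sup>2" for k
  proof -
    \<comment> \<open>Replacing \<open>g k\<close> by the exact gradient costs at most
      \<open>\<zeta> * c2'\<close> of the descent constant \<open>c1'\<close>.\<close>
    have "(gradF (z k) - g k) \<bullet> s k \<le> norm (gradF (z k) - g k) * norm (s k)"
      by (rule norm_cauchy_schwarz)
    also have "\<dots> \<le> (\<zeta> * norm (g k)) * (c2' * norm (g k))"
      using inexact[of k] direction_bound[of k] \<zeta>0 by (intro mult_mono) (auto simp: norm_minus_commute)
    finally have "gradF (z k) \<bullet> s k \<le> - ((c1' - \<zeta> * c2') * (norm (g k))\<^sup>2)"
      using descent[of k] by (simp add: inner_diff_left algebra_simps power2_eq_square)
    \<comment> \<open>Monotonicity needs \<open>c1 \<ge> 0\<close>, which holds by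
      \<open>\<zeta> * c2' < c1'\<close>.\<close>
    moreover have "c1 * (norm (gradF (z k)))\<^sup>2 \<le> c1 * ((1 + \<zeta>) * norm (g k))\<^sup>2"
      using upper[of k] c1 \<zeta>c by (intro mult_left_mono power_mono) auto
    moreover have "c1 * ((1 + \<zeta>) * norm (g k))\<^sup>2 = (c1' - \<zeta> * c2') * (norm (g k))\<^sup>2"
      using c1 \<zeta>0 by (simp add: power_mult_distrib)
    ultimately show ?thesis
      by simp
  qed
  have len: "norm (s k) \<le> c2 * norm (gradF (z k))" for k
    using direction_bound[of k] mult_left_mono[OF lower[of k], of c2'] c2 c2'_pos by simp
  have decr: "t_bar * \<gamma> / 2 * (norm (gradF (z k)))\<^sup>2 \<le> F (z k) - F (z (Suc k))" for k
  proof -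
    define N where "N = (norm (gradF (z k)))\<^sup>2"
    have "F (z (Suc k)) \<le> F (z k) + t k * (gradF (z k) \<bullet> s k) + L / 2 * (t k)\<^sup>2 * (norm (s k))\<^sup>2"
      using lipschitz_gradient_upper_bound[OF grad lipschitz_grad, of "z k" "t k *\<^sub>R s k"]
      by (simp add: step power_mult_distrib)
    moreover have "t k * (gradF (z k) \<bullet> s k) \<le> t k * (- c1 * N)"
      using slope[of k] t_pos[of k] by (intro mult_left_mono) (auto simp: N_def)
    moreover have "(norm (s k))\<^sup>2 \<le> c2\<^sup>2 * N"
      using power_mono[OF len[of k], of 2] by (simp add: N_def power_mult_distrib)
    then have "L / 2 * (t k)\<^sup>2 * (norm (s k))\<^sup>2 \<le> L / 2 * (t k)\<^sup>2 * (c2\<^sup>2 * N)"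
      using L_pos by (intro mult_left_mono) auto
    \<comment> \<open>The upper limit on the step size keeps the quadratic term below
      \<open>t k * (c1 - \<gamma> / 2) * N\<close>, so \<open>t k * \<gamma> / 2 * N\<close> of the
      linear decrease survives.\<close>
    moreover have "t k * (c2\<^sup>2 * L) \<le> 2 * c1 - \<gamma>"
      using step_size[of k] c2_pos L_pos by (simp add: pos_le_divide_eq)
    then have "t k * N / 2 * (t k * (c2\<^sup>2 * L)) \<le> t k * N / 2 * (2 * c1 - \<gamma>)"
      using t_pos[of k] by (intro mult_left_mono) (auto simp: N_def)
    \<comment> \<open>The lower limit on the step size makes the coefficient independent of
      \<open>k\<close>.\<close>
    moreover have "t_bar * (\<gamma> / 2 * N) \<le> t k * (\<gamma> / 2 * N)"
      using step_size[of k] gamma_pos by (intro mult_right_mono) (auto simp: N_def)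
    ultimately show ?thesis
      unfolding N_def [symmetric] by (simp add: power2_eq_square algebra_simps)
  qed
  have "(\<lambda>k. t_bar * \<gamma> / 2 * (norm (gradF (z k)))\<^sup>2) \<longlonglongrightarrow> 0"
    using decr bounded_below t_bar_pos gamma_pos
    by (intro tendsto_zero_if_le_decrement[where f = "\<lambda>k. F (z k)" and m = F_inf]) auto
  from tendsto_mult_left[OF this, of "2 / (t_bar * \<gamma>)"]
  have "(\<lambda>k. (norm (gradF (z k)))\<^sup>2) \<longlonglongrightarrow> 0"
    using t_bar_pos gamma_pos by simp
  from tendsto_real_sqrt[OF this] have gradF_lim: "(\<lambda>k. gradF (z k)) \<longlonglongrightarrow> 0"
    by (simp add: tendsto_norm_zero_iff)
  have "(\<lambda>k. norm (gradF (z k)) / (1 - \<zeta>)) \<longlonglongrightarrow> 0"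
    by (rule tendsto_divide_zero[OF tendsto_norm_zero[OF gradF_lim]])
  then have "g \<longlonglongrightarrow> 0"
    by (rule Lim_null_comparison[OF always_eventually, rotated]) (use lower in blast)
  \<comment> \<open>Along the subsequence the gradients tend to \<open>gradF x\<close> by continuity
    and to 0 by the limit just obtained.\<close>
  moreover have "gradF x = 0" if r: "strict_mono r" and x: "(z \<circ> r) \<longlonglongrightarrow> x" for x and r :: "nat \<Rightarrow> nat"
  proof (rule LIMSEQ_unique)
    show "(\<lambda>k. gradF ((z \<circ> r) k)) \<longlonglongrightarrow> gradF x"
      using continuous_on_tendsto_compose[OF cont_grad x] by simp
    show "(\<lambda>k. gradF ((z \<circ> r) k)) \<longlonglongrightarrow> 0"
      using LIMSEQ_subseq_LIMSEQ[OF gradF_lim r] by (simp add: o_def)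
  qed
  ultimately show ?thesis
    using gradF_lim by blast
qed

end
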